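(* Let $w(x)=w_0(|x|)$ be a radial weight. Assume that there exist $N>0$ and $C>0$ such that $(w)_{A_1(\mathbb R^n)}<C$ for all $n>N$. Then for all $n>N$, all radial locally integrable functions $f$ on $\mathbb R^n$ and all $\lambda>0$ one has $$w\big(\{x\in\mathbb R^n: Mf(x)>\lambda\}\big)\le\frac{4C}{\lambda}\int_{\mathbb R^n}|f(x)|\,w(x)\,dx.$$
   Context: A weight on $\mathbb R^n$ is an a.e. nonnegative, locally integrable function; for a measurable set $E$, $w(E)=\int_E w$. A radial weight is given by $w_0:[0,\infty)\to[0,\infty]$ through $w(x)=w_0(|x|)$, considered in all dimensions. The centered Hardy–Littlewood maximal operator on $\mathbb R^n$ is $Mg(x)=\sup_{R>0}\frac1{|B_R(x)|}\int_{B_R(x)}|g(y)|\,dy$, with $B_R(x)$ the Euclidean ball of radius $R$ centered at $x$. The constant $(w)_{A_1(\mathbb R^n)}$ is the smallest $C>0$ such that $$\frac{\int_I w_0(t)t^{n-1}\,dt}{\int_I t^{n-1}\,dt}\le C\operatorname*{ess\,inf}_{t\in I}w_0(t)$$ for all bounded intervals $I\subset[0,\infty)$ of positive length. *)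

theory Defs
  imports "HOL-Analysis.Analysis"
begin

text \<open>Weights may take the value \<open>\<infinity>\<close>, so they are \<^typ>\<open>ennreal\<close>-valued.  All integrals
  are with respect to the completed Lebesgue measure \<^term>\<open>lebesgue\<close>.\<close>

definition weight :: "('a::euclidean_space \<Rightarrow> ennreal) \<Rightarrow> bool" where
  "weight w \<longleftrightarrow> w \<in> borel_measurable lebesgue \<and>
     (\<forall>K. compact K \<longrightarrow> (\<integral>\<^sup>+x\<in>K. w x \<partial>lebesgue) < \<infinity>)"

definition weighted_measure :: "('a::euclidean_space \<Rightarrow> ennreal) \<Rightarrow> 'a set \<Rightarrow> ennreal" where
  "weighted_measure w E = (\<integral>\<^sup>+x\<in>E. w x \<partial>lebesgue)"

text \<open>A radial weight is given by its profile \<open>w\<^sub>0\<close> on \<open>[0,\<infinity>)\<close>, which makes sense in every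
  dimension; the values of the profile at negative reals are never used.\<close>

definition radial_extension :: "(real \<Rightarrow> 'b) \<Rightarrow> 'a::real_normed_vector \<Rightarrow> 'b" where
  "radial_extension w\<^sub>0 x = w\<^sub>0 (norm x)"

definition radial :: "('a::real_normed_vector \<Rightarrow> 'b) \<Rightarrow> bool" where
  "radial f \<longleftrightarrow> (\<exists>f\<^sub>0. f = radial_extension f\<^sub>0)"

definition locally_integrable ::
    "('a::euclidean_space \<Rightarrow> 'b::{banach, second_countable_topology}) \<Rightarrow> bool" where
  "locally_integrable f \<longleftrightarrow> (\<forall>K. compact K \<longrightarrow> set_integrable lebesgue K f)"

definition maximal_op ::
    "('a::euclidean_space \<Rightarrow> 'b::real_normed_vector) \<Rightarrow> 'a \<Rightarrow> ennreal" where
  "maximal_op g x = (SUP R\<in>{0<..}.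
     (\<integral>\<^sup>+y\<in>ball x R. ennreal (norm (g y)) \<partial>lebesgue) / emeasure lebesgue (ball x R))"

definition ess_inf_on :: "'a::euclidean_space set \<Rightarrow> ('a \<Rightarrow> ennreal) \<Rightarrow> ennreal" where
  "ess_inf_on I g = Sup {z. AE t\<in>I in lebesgue. z \<le> g t}"

definition radial_interval :: "real set \<Rightarrow> bool" where
  "radial_interval I \<longleftrightarrow>
     is_interval I \<and> bounded I \<and> I \<subseteq> {0..} \<and> 0 < emeasure lebesgue I"

text \<open>The smallest admissible constant \<open>C > 0\<close> is rendered as an infimum in \<^typ>\<open>ennreal\<close>;
  it is \<open>\<infinity>\<close> if there is no admissible constant.\<close>

definition A1_const :: "nat \<Rightarrow> (real \<Rightarrow> ennreal) \<Rightarrow> ennreal" where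
  "A1_const n w\<^sub>0 = Inf {ennreal C | C. 0 < C \<and>
     (\<forall>I. radial_interval I \<longrightarrow>
       (\<integral>\<^sup>+t\<in>I. w\<^sub>0 t * ennreal (t ^ (n - 1)) \<partial>lebesgue) /
         (\<integral>\<^sup>+t\<in>I. ennreal (t ^ (n - 1)) \<partial>lebesgue)
       \<le> ennreal C * ess_inf_on I w\<^sub>0)}"

end

theory Submission
  imports Defs
begin

text \<open>
  Why the theorem holds.  Fix the dimension \<open>n\<close>, write \<open>\<mu>\<close> for the measure \<open>n t\<^sup>n\<^sup>-\<^sup>1 dt\<close> on
  \<open>[0,\<infinity>)\<close> and \<open>g\<close>, \<open>w\<close> for the profiles of \<open>\<bar>f\<bar>\<close> and of the weight.  The heart of the matter is
  that the maximal function of a radial function is at most twice the uncentered maximal function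
  of its profile with respect to \<open>\<mu>\<close>: if \<open>\<lambda> < Mf(x)\<close>, then some interval \<open>I\<close> that contains
  \<open>\<bar>x\<bar>\<close> has \<open>\<integral>\<^sub>I g d\<mu> > (\<lambda>/2) \<mu>(I)\<close>.

  To see this, integrate over a ball \<open>B = B\<^sub>R(x)\<close> ray by ray, in polar coordinates.  A ray meets
  \<open>B\<close> in an interval \<open>J\<close> of radii, and \<open>J\<close> enlarged so as to reach the radius \<open>\<bar>x\<bar>\<close> is an
  interval to which an assumed bound \<open>\<integral>\<^sub>I g d\<mu> \<le> T \<mu>(I)\<close> applies.  Summing over all rays gives
  \<open>\<integral>\<^sub>B \<bar>f\<bar> \<le> T \<bar>S\<bar>\<close>, where \<open>S\<close> is the union of all these enlarged segments.  The part of \<open>S\<close>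
  outside \<open>B\<close> fits into one further ball of radius \<open>R\<close>, whence \<open>\<bar>S\<bar> \<le> 2\<bar>B\<bar>\<close>.  The second
  ball is centered at the origin if \<open>\<bar>x\<bar> \<le> R\<close>; otherwise its center lies on the segment
  from \<open>0\<close> to \<open>x\<close>, and its distance to \<open>0\<close> is the length of the tangents from \<open>0\<close> to \<open>B\<close>
  (\<open>ray_ball_hull\<close>, \<open>nn_integral_radial_ball_le\<close>).

  What is left is one-dimensional.  Finitely many intervals can be thinned out to a subfamily with
  the same union and overlap at most two, so an inequality between two measures on the
  intervals of a family passes to their union at the cost of a factor \<open>2\<close>
  (\<open>emeasure_Union_intervals_le\<close>).  On an interval with \<open>T \<mu>(I) < \<integral>\<^sub>I g d\<mu>\<close> the \<open>A\<^sub>1\<close> condition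
  gives
  \<open>T \<integral>\<^sub>I w d\<mu> \<le> C (ess inf\<^sub>I w) T \<mu>(I) \<le> C (ess inf\<^sub>I w) \<integral>\<^sub>I g d\<mu> \<le> C \<integral>\<^sub>I g w d\<mu>\<close>
  (\<open>A1_weak_type_intervals\<close>).  With \<open>T = \<lambda>/2\<close> the two factors \<open>2\<close> make up the constant \<open>4C\<close>.
\<close>

section \<open>Polar coordinates\<close>

text \<open>The measure \<open>n t\<^sup>n\<^sup>-\<^sup>1 dt\<close> on \<open>[0,\<infinity>)\<close>, normalised so that \<open>[0,a]\<close> has mass \<open>a\<^sup>n\<close>.  It lives on
  the whole line and vanishes on negative numbers, so that open intervals of reals can be
  used in place of relatively open subintervals of \<open>[0,\<infinity>)\<close>.\<close>

definition radial_measure :: "nat \<Rightarrow> real measure" where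
  "radial_measure n = density lborel (\<lambda>t. ennreal (real n * t ^ (n - 1)) * indicator {0..} t)"

lemma sets_radial_measure [simp, measurable_cong]: "sets (radial_measure n) = sets borel"
  and space_radial_measure [simp]: "space (radial_measure n) = UNIV"
  by (simp_all add: radial_measure_def)

lemma emeasure_radial_measure_atMost:
  assumes "n > 0"
  shows "emeasure (radial_measure n) {..a} = (if a < 0 then 0 else ennreal (a ^ n))"
proof -
  have "emeasure (radial_measure n) {..a} =
      (\<integral>\<^sup>+t. ennreal (real n * t ^ (n - 1)) * indicator {0..a} t \<partial>lborel)"
    unfolding radial_measure_def
    by (subst emeasure_density) (auto intro!: nn_integral_cong simp: indicator_def)
  also have "\<dots> = (if a < 0 then 0 else ennreal (a ^ n))"
  proof (cases "a < 0")
    case False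
    then have "(\<integral>\<^sup>+t. ennreal (real n * t ^ (n - 1)) * indicator {0..a} t \<partial>lborel) = ennreal (a ^ n - 0 ^ n)"
      by (intro nn_integral_FTC_Icc) (auto intro!: derivative_eq_intros simp: mult.assoc)
    with False assms show ?thesis by (simp add: zero_power)
  qed auto
  finally show ?thesis .
qed

lemma AE_radial_measure_iff:
  assumes "n > 0"
  shows "(AE t in radial_measure n. P t) \<longleftrightarrow> (AE t in lborel. 0 \<le> t \<longrightarrow> P t)"
proof -
  have "(AE t in radial_measure n. P t) \<longleftrightarrow> (AE t in lborel. 0 < ennreal (real n * t ^ (n - 1)) * indicator {0..} t \<longrightarrow> P t)"
    unfolding radial_measure_def by (rule AE_density) simp
  also have "\<dots> \<longleftrightarrow> (AE t in lborel. 0 \<le> t \<longrightarrow> P t)"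
  proof -
    have "AE t in lborel. t \<noteq> (0::real)"
      by (rule AE_lborel_singleton)
    then have "\<forall>\<^sub>F t in ae_filter lborel. (0 < ennreal (real n * t ^ (n - 1)) * indicator {0..} t \<longrightarrow> P t) \<longleftrightarrow> (0 \<le> t \<longrightarrow> P t)"
      by eventually_elim (use assms in \<open>auto simp: indicator_def ennreal_zero_less_mult_iff zero_less_mult_iff\<close>)
    then show ?thesis
      by (rule eventually_subst)
  qed
  finally show ?thesis .
qed

lemma sigma_finite_radial_measure:
  assumes "n > 0"
  shows "sigma_finite_measure (radial_measure n)"
proof
  show "\<exists>A. countable A \<and> A \<subseteq> sets (radial_measure n) \<and> \<Union>A = space (radial_measure n) \<and> (\<forall>a\<in>A. emeasure (radial_measure n) a \<noteq> \<infinity>)"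
    by (rule exI[of _ "range (\<lambda>i::nat. {..real i})"])
       (auto simp: emeasure_radial_measure_atMost[OF assms] real_arch_simple)
qed

text \<open>Surface measure on the unit sphere, divided by the dimension: the mass of a set of directions
  is the volume of the part of the unit ball that lies in these directions.\<close>

definition direction_measure :: "'a::euclidean_space measure" where
  "direction_measure = distr (restrict_space lborel (cball 0 1)) borel sgn"

lemma borel_measurable_sgn_euclidean [measurable]:
  "sgn \<in> borel_measurable (borel :: 'a::euclidean_space measure)"
  unfolding sgn_div_norm[abs_def] by measurable

lemma sets_direction_measure [simp, measurable_cong]: "sets direction_measure = sets borel"
  and space_direction_measure [simp]: "space direction_measure = UNIV"
  by (simp_all add: direction_measure_def)

lemma measurable_sgn_restrict [measurable]: "sgn \<in> restrict_space lborel (A :: 'a::euclidean_space set) \<rightarrow>\<^sub>M borel"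
  by (intro measurable_restrict_space1) simp

lemma emeasure_direction_measure:
  fixes S :: "'a::euclidean_space set"
  assumes [measurable]: "S \<in> sets borel"
  shows "emeasure direction_measure S = emeasure lborel {y. norm y \<le> 1 \<and> sgn y \<in> S}"
  unfolding direction_measure_def
  by (subst emeasure_distr; simp?; subst emeasure_restrict_space)
     (auto simp: space_restrict_space intro!: arg_cong[of _ _ "emeasure lborel"])

lemma finite_direction_measure: "finite_measure (direction_measure :: 'a::euclidean_space measure)"
proof
  have "{y::'a. norm y \<le> 1} = cball 0 1" by auto
  then show "emeasure direction_measure (space (direction_measure :: 'a measure)) \<noteq> \<infinity>"
    using emeasure_lborel_cball_finite[of "0::'a" 1]
    by (simp add: emeasure_direction_measure)
qed

text \<open>A cone is invariant under dilations, and a dilation by \<open>a\<close> multiplies volumes by \<open>a\<^sup>n\<close>.\<close>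

lemma emeasure_cone:
  fixes S :: "'a::euclidean_space set"
  assumes [measurable]: "S \<in> sets borel"
  shows "emeasure lborel {y. norm y \<le> a \<and> sgn y \<in> S} =
    emeasure (radial_measure DIM('a)) {..a} * emeasure direction_measure S"
proof -
  consider "a < 0" | "a = 0" | "a > 0" by linarith
  then show ?thesis
  proof cases
    case 1
    then have "{y::'a. norm y \<le> a \<and> sgn y \<in> S} = {}"
      by (auto dest: order_trans[OF norm_ge_zero])
    with 1 show ?thesis by (simp only: emeasure_radial_measure_atMost[OF DIM_positive] emeasure_empty if_True mult_zero_left)
  next
    case 2
    have "emeasure lborel {y::'a. norm y \<le> a \<and> sgn y \<in> S} \<le> emeasure lborel {0::'a}"
      using 2 by (intro emeasure_mono) auto
    with 2 show ?thesis by (simp add: emeasure_radial_measure_atMost)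
  next
    case 3
    let ?A = "{y::'a. norm y \<le> a \<and> sgn y \<in> S}"
    have "emeasure lborel ?A = emeasure (density (distr lborel borel (\<lambda>y. 0 + a *\<^sub>R y)) (\<lambda>_. ennreal (\<bar>a\<bar> ^ DIM('a)))) ?A"
      using lborel_affine[of a "0::'a"] 3 by simp
    also have "\<dots> = ennreal (a ^ DIM('a)) * emeasure lborel ((\<lambda>y. a *\<^sub>R y) -` ?A)"
      using 3 by (subst emeasure_density_const) (auto simp: emeasure_distr)
    also have "(\<lambda>y. a *\<^sub>R y) -` ?A = {y. norm y \<le> 1 \<and> sgn y \<in> S}"
      using 3 by (auto simp: sgn_scaleR)
    finally show ?thesis
      using 3 by (simp add: emeasure_radial_measure_atMost emeasure_direction_measure)
  qed
qed

text \<open>Both sides agree on rectangles: for a fixed set of directions, the two measures in the radius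
  agree on the half-lines \<open>{..a}\<close> by the scaling of cones, and these generate the Borel sets.\<close>

lemma distr_polar_coordinates:
  "distr lborel (borel \<Otimes>\<^sub>M borel) (\<lambda>y::'a::euclidean_space. (norm y, sgn y)) =
     radial_measure DIM('a) \<Otimes>\<^sub>M direction_measure"
proof (rule pair_measure_eqI[symmetric])
  show "sigma_finite_measure (radial_measure DIM('a))"
    by (simp add: sigma_finite_radial_measure)
  show "sigma_finite_measure (direction_measure :: 'a measure)"
    using finite_direction_measure finite_measure.axioms(1) by blast
  show "sets (radial_measure DIM('a) \<Otimes>\<^sub>M (direction_measure :: 'a measure)) =
      sets (distr lborel (borel \<Otimes>\<^sub>M borel) (\<lambda>y::'a. (norm y, sgn y)))"
    by (simp cong: sets_pair_measure_cong)
next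
  fix A :: "real set" and S :: "'a set"
  assume "A \<in> sets (radial_measure DIM('a))" and "S \<in> sets direction_measure"
  then have [measurable]: "A \<in> sets borel" "S \<in> sets borel" by auto
  let ?D = "distr (restrict_space lborel {y. sgn y \<in> S}) borel (norm :: 'a \<Rightarrow> real)"
  let ?R = "scale_measure (emeasure direction_measure S) (radial_measure DIM('a))"
  have D: "emeasure ?D B = emeasure lborel {y. norm y \<in> B \<and> sgn y \<in> S}" if [measurable]: "B \<in> sets borel" for B
    by (subst emeasure_distr; simp?; (subst emeasure_restrict_space)?)
     (auto simp: space_restrict_space intro!: arg_cong[of _ _ "emeasure lborel"] measurable_restrict_space1)
  have "?D = ?R"
  proof (rule measure_eqI_generator_eq[where E="range atMost" and \<Omega>=UNIV and A="\<lambda>i. {..real i}"])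
    show "Int_stable (range (atMost :: real \<Rightarrow> _))"
      by (auto simp: Int_stable_def)
    show "emeasure ?D X = emeasure ?R X" if "X \<in> range atMost" for X
      using that by (auto simp: D emeasure_cone mult.commute)
    show "emeasure ?D {..real i} \<noteq> \<infinity>" for i
      using finite_measure.emeasure_finite[OF finite_direction_measure, of S]
      by (simp add: D emeasure_cone emeasure_radial_measure_atMost ennreal_mult_eq_top_iff)
    have "sets borel = sigma_sets UNIV (range (atMost :: real \<Rightarrow> _))"
      unfolding borel_eq_atMost by simp
    then show "sets ?D = sigma_sets UNIV (range atMost)" "sets ?R = sigma_sets UNIV (range atMost)"
      by simp_all
    show "(\<Union>i. {..real i}) = UNIV"
      by (auto intro: real_arch_simple)
  qed auto
  then have "emeasure ?D A = emeasure ?R A" by (rule arg_cong)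
  also have "emeasure ?D A = emeasure lborel ((\<lambda>y::'a. (norm y, sgn y)) -` (A \<times> S) \<inter> space lborel)"
    unfolding D[OF \<open>A \<in> sets borel\<close>] by (rule arg_cong[of _ _ "emeasure lborel"]) auto
  also have "\<dots> = emeasure (distr lborel (borel \<Otimes>\<^sub>M borel) (\<lambda>y::'a. (norm y, sgn y))) (A \<times> S)"
    by (rule emeasure_distr[symmetric]) measurable
  finally show "emeasure (radial_measure DIM('a)) A * emeasure direction_measure S =
      emeasure (distr lborel (borel \<Otimes>\<^sub>M borel) (\<lambda>y::'a. (norm y, sgn y))) (A \<times> S)"
    by (simp add: mult.commute)
qed

lemma nn_integral_polar:
  fixes h :: "'a::euclidean_space \<Rightarrow> ennreal"
  assumes [measurable]: "h \<in> borel_measurable borel"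
  shows "(\<integral>\<^sup>+y. h y \<partial>lborel) =
    (\<integral>\<^sup>+\<theta>. \<integral>\<^sup>+t. h (t *\<^sub>R \<theta>) \<partial>radial_measure DIM('a) \<partial>direction_measure)"
proof -
  interpret R: sigma_finite_measure "radial_measure DIM('a)"
    by (simp add: sigma_finite_radial_measure)
  interpret D: finite_measure "direction_measure :: 'a measure"
    by (rule finite_direction_measure)
  interpret pair_sigma_finite "radial_measure DIM('a)" "direction_measure :: 'a measure" ..
  have "norm y *\<^sub>R sgn y = y" for y :: 'a
    by (cases "y = 0") (simp_all add: sgn_div_norm)
  then have "(\<integral>\<^sup>+y. h y \<partial>lborel) = (\<integral>\<^sup>+y. (\<lambda>p. h (fst p *\<^sub>R snd p)) (norm y, sgn y) \<partial>lborel)"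
    by simp
  also have "\<dots> = (\<integral>\<^sup>+p. h (fst p *\<^sub>R snd p) \<partial>distr lborel (borel \<Otimes>\<^sub>M borel) (\<lambda>y::'a. (norm y, sgn y)))"
    by (rule nn_integral_distr[symmetric]) measurable
  also have "\<dots> = (\<integral>\<^sup>+p. h (fst p *\<^sub>R snd p) \<partial>(radial_measure DIM('a) \<Otimes>\<^sub>M direction_measure))"
    by (simp only: distr_polar_coordinates)
  also have "\<dots> = (\<integral>\<^sup>+\<theta>. \<integral>\<^sup>+t. h (fst (t, \<theta>) *\<^sub>R snd (t, \<theta>)) \<partial>radial_measure DIM('a) \<partial>direction_measure)"
    by (rule nn_integral_snd[symmetric]) measurable
  finally show ?thesis by (simp only: fst_conv snd_conv)
qed

lemma AE_direction_measure_norm: "AE \<theta>::'a::euclidean_space in direction_measure. norm \<theta> = 1"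
proof (rule AE_I)
  have "emeasure direction_measure {\<theta>::'a. norm \<theta> \<noteq> 1} =
      emeasure lborel {y::'a. norm y \<le> 1 \<and> sgn y \<in> {\<theta>. norm \<theta> \<noteq> 1}}"
    by (rule emeasure_direction_measure) measurable
  also have "\<dots> \<le> emeasure lborel {0::'a}"
    by (rule emeasure_mono) (auto simp: norm_sgn split: if_splits)
  finally show "emeasure direction_measure {\<theta>::'a. norm \<theta> \<noteq> 1} = 0"
    by simp
qed auto

lemma nn_integral_norm:
  assumes [measurable]: "h \<in> borel_measurable borel"
  shows "(\<integral>\<^sup>+y. h (norm (y::'a::euclidean_space)) \<partial>lborel) =
    emeasure (direction_measure :: 'a measure) UNIV * (\<integral>\<^sup>+t. h t \<partial>radial_measure DIM('a))"
proof -
  have nonneg: "AE t in radial_measure DIM('a). 0 \<le> t"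
    by (simp add: AE_radial_measure_iff)
  have "(\<integral>\<^sup>+y. h (norm (y::'a)) \<partial>lborel) =
     (\<integral>\<^sup>+\<theta>. \<integral>\<^sup>+t. h (norm (t *\<^sub>R \<theta>)) \<partial>radial_measure DIM('a) \<partial>(direction_measure :: 'a measure))"
    by (rule nn_integral_polar) simp
  also have "\<dots> = (\<integral>\<^sup>+\<theta>. \<integral>\<^sup>+t. h t \<partial>radial_measure DIM('a) \<partial>(direction_measure :: 'a measure))"
  proof (rule nn_integral_cong_AE, use AE_direction_measure_norm in eventually_elim)
    fix \<theta> :: 'a assume "norm \<theta> = 1"
    from nonneg have "AE t in radial_measure DIM('a). h (norm (t *\<^sub>R \<theta>)) = h t"
      by eventually_elim (simp add: \<open>norm \<theta> = 1\<close>)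
    then show "(\<integral>\<^sup>+t. h (norm (t *\<^sub>R \<theta>)) \<partial>radial_measure DIM('a)) = (\<integral>\<^sup>+t. h t \<partial>radial_measure DIM('a))"
      by (rule nn_integral_cong_AE)
  qed
  finally show ?thesis by (simp add: mult.commute)
qed

lemma AE_norm_lborel:
  assumes "AE t in lborel. 0 \<le> t \<longrightarrow> P t"
  shows "AE y::'a::euclidean_space in lborel. P (norm y)"
proof -
  from assms have "AE t in radial_measure DIM('a). P t"
    by (simp add: AE_radial_measure_iff)
  then obtain N where N: "N \<in> null_sets (radial_measure DIM('a))" "{t. \<not> P t} \<subseteq> N"
    by (auto simp: eventually_ae_filter)
  then have [measurable]: "N \<in> sets borel" by auto
  have "(\<integral>\<^sup>+y. indicator N (norm (y::'a)) \<partial>lborel) = 0"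
    using N by (subst nn_integral_norm) auto
  then have "AE y::'a in lborel. indicator N (norm y) = (0::ennreal)"
    by (subst (asm) nn_integral_0_iff_AE) auto
  then show ?thesis
    by eventually_elim (use N in \<open>auto simp: indicator_def split: if_splits\<close>)
qed

lemma AE_exists:
  assumes "AE x in M. P x" "emeasure M (space M) \<noteq> 0"
  shows "\<exists>x. P x"
proof (rule ccontr)
  assume "\<nexists>x. P x"
  with assms(1) have "AE x in M. False" by simp
  with assms(2) show False by (simp add: AE_iff_null null_setsD1)
qed

text \<open>The passage from a measurable radial function to a measurable profile is not formal: sets of radii
  have to be recovered from sets of points.  A Borel function \<open>H\<close> that agrees with \<open>h(\<bar>y\<bar>)\<close> almost
  everywhere does so, by Fubini in polar coordinates, almost everywhere along the ray in some
  direction \<open>\<theta>\<close>.  The restriction of \<open>H\<close> to that ray is the Borel profile.\<close>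

lemma radial_borel_profile:
  fixes h :: "real \<Rightarrow> ennreal"
  assumes "radial_extension h \<in> borel_measurable (lebesgue :: 'a::euclidean_space measure)"
  obtains h' where "h' \<in> borel_measurable borel"
    "AE t in lborel. 0 \<le> t \<longrightarrow> h t = h' t"
proof -
  obtain H where [measurable]: "H \<in> borel_measurable (lborel :: 'a measure)"
    and H: "AE y in lborel. radial_extension h y = H y"
    using completion_ex_borel_measurable[OF assms] by auto
  obtain N where N: "N \<in> null_sets lborel" "{y. radial_extension h y \<noteq> H y} \<subseteq> N"
    using H by (auto simp: eventually_ae_filter)
  have [measurable]: "N \<in> sets borel" using N by auto
  interpret R: sigma_finite_measure "radial_measure DIM('a)"
    by (simp add: sigma_finite_radial_measure)
  have "(\<integral>\<^sup>+\<theta>. \<integral>\<^sup>+t. indicator N (t *\<^sub>R \<theta>) \<partial>radial_measure DIM('a) \<partial>(direction_measure :: 'a measure)) = 0"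
    using N by (subst nn_integral_polar[symmetric]) auto
  then have "AE \<theta>::'a in direction_measure. (\<integral>\<^sup>+t. indicator N (t *\<^sub>R \<theta>) \<partial>radial_measure DIM('a)) = 0"
    by (subst (asm) nn_integral_0_iff_AE) auto
  with AE_direction_measure_norm
  have "AE \<theta>::'a in direction_measure. norm \<theta> = 1 \<and> (\<integral>\<^sup>+t. indicator N (t *\<^sub>R \<theta>) \<partial>radial_measure DIM('a)) = 0"
    by eventually_elim auto
  moreover have "emeasure (direction_measure :: 'a measure) UNIV \<noteq> 0"
  proof -
    have "{y::'a. norm y \<le> 1} = cball 0 1" by auto
    then show ?thesis
      using content_cball_pos[of 1 "0::'a"] by (auto simp: emeasure_direction_measure measure_def)
  qed
  ultimately have "\<exists>\<theta>::'a. norm \<theta> = 1 \<and> (\<integral>\<^sup>+t. indicator N (t *\<^sub>R \<theta>) \<partial>radial_measure DIM('a)) = 0"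
    by (intro AE_exists[where M=direction_measure]) simp_all
  then obtain \<theta> :: 'a where \<theta>: "norm \<theta> = 1" "(\<integral>\<^sup>+t. indicator N (t *\<^sub>R \<theta>) \<partial>radial_measure DIM('a)) = 0"
    by blast
  then have "AE t in radial_measure DIM('a). indicator N (t *\<^sub>R \<theta>) = (0::ennreal)"
    by (subst (asm) nn_integral_0_iff_AE) auto
  then have "AE t in lborel. 0 \<le> t \<longrightarrow> indicator N (t *\<^sub>R \<theta>) = (0::ennreal)"
    by (simp add: AE_radial_measure_iff)
  then have "AE t in lborel. 0 \<le> t \<longrightarrow> h t = H (t *\<^sub>R \<theta>)"
  proof (eventually_elim, intro impI)
    fix t :: real
    assume "0 \<le> t \<longrightarrow> indicator N (t *\<^sub>R \<theta>) = (0::ennreal)" "0 \<le> t"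
    with N \<theta> have "radial_extension h (t *\<^sub>R \<theta>) = H (t *\<^sub>R \<theta>)"
      by (auto simp: indicator_def split: if_splits)
    with \<theta> \<open>0 \<le> t\<close> show "h t = H (t *\<^sub>R \<theta>)" by (simp add: radial_extension_def)
  qed
  then show ?thesis by (intro that[of "\<lambda>t. H (t *\<^sub>R \<theta>)"]) auto
qed

section \<open>Families of intervals\<close>

text \<open>Of three or more intervals through a common point, the one that reaches furthest to the left and
  the one that reaches furthest to the right cover all others.\<close>

lemma overlapping_intervals_redundant:
  fixes T :: "(real \<times> real) set"
  assumes "card T > 2" and x: "\<And>p. p \<in> T \<Longrightarrow> x \<in> {fst p<..<snd p}"
  shows "\<exists>r\<in>T. {fst r<..<snd r} \<subseteq> (\<Union>p\<in>T - {r}. {fst p<..<snd p})"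
proof -
  have "finite T" using assms(1) by (intro card_ge_0_finite) simp
  moreover have "T \<noteq> {}" using assms(1) by auto
  ultimately have T: "finite T" "T \<noteq> {}" .
  define l where "l = arg_min_on fst T"
  define m where "m = arg_min_on (\<lambda>p. - snd p) T"
  have l: "l \<in> T" "\<And>p. p \<in> T \<Longrightarrow> fst l \<le> fst p"
    using T arg_min_if_finite(1)[of T fst] arg_min_least[of T _ fst] by (auto simp: l_def)
  have m: "m \<in> T" "\<And>p. p \<in> T \<Longrightarrow> snd p \<le> snd m"
    using T arg_min_if_finite(1)[of T "\<lambda>p. - snd p"] arg_min_least[of T _ "\<lambda>p. - snd p"] by (auto simp: m_def)
  have "\<not> T \<subseteq> {l, m}"
  proof
    assume "T \<subseteq> {l, m}"
    then have "card T \<le> card {l, m}" by (intro card_mono) auto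
    also have "\<dots> \<le> 2" by (simp add: card_insert_if)
    finally show False using assms(1) by simp
  qed
  then obtain r where r: "r \<in> T" "r \<noteq> l" "r \<noteq> m" by auto
  have "{fst r<..<snd r} \<subseteq> {fst l<..<snd l} \<union> {fst m<..<snd m}"
    using l(2)[OF r(1)] m(2)[OF r(1)] x[OF l(1)] x[OF m(1)] by auto
  also have "\<dots> \<subseteq> (\<Union>p\<in>T - {r}. {fst p<..<snd p})"
    using l m r by (intro Un_least UN_upper) auto
  finally show ?thesis using r(1) by (rule bexI)
qed

lemma finite_intervals_overlap_two:
  fixes F :: "(real \<times> real) set"
  assumes "finite F"
  shows "\<exists>G\<subseteq>F. (\<Union>p\<in>G. {fst p<..<snd p}) = (\<Union>p\<in>F. {fst p<..<snd p}) \<and>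
     (\<forall>x. card {p \<in> G. x \<in> {fst p<..<snd p}} \<le> 2)"
  using assms
proof (induction F rule: finite_psubset_induct)
  case (psubset F)
  show ?case
  proof (cases "\<forall>x. card {p \<in> F. x \<in> {fst p<..<snd p}} \<le> 2")
    case True
    then show ?thesis by (intro exI[of _ F]) simp
  next
    case False
    then obtain x where "card {p \<in> F. x \<in> {fst p<..<snd p}} > 2" by (auto simp: not_le)
    then have "\<exists>r\<in>{p \<in> F. x \<in> {fst p<..<snd p}}.
        {fst r<..<snd r} \<subseteq> (\<Union>p\<in>{p \<in> F. x \<in> {fst p<..<snd p}} - {r}. {fst p<..<snd p})"
      by (rule overlapping_intervals_redundant[where x=x]) simp
    then obtain r where r: "r \<in> {p \<in> F. x \<in> {fst p<..<snd p}}"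
      "{fst r<..<snd r} \<subseteq> (\<Union>p\<in>{p \<in> F. x \<in> {fst p<..<snd p}} - {r}. {fst p<..<snd p})"
      by (rule bexE)
    have F: "F = insert r (F - {r})" using r by auto
    have sub: "{fst r<..<snd r} \<subseteq> (\<Union>p\<in>F - {r}. {fst p<..<snd p})"
      using r(2) by (rule order_trans) (intro UN_mono, auto)
    have "(\<Union>p\<in>insert r (F - {r}). {fst p<..<snd p}) = (\<Union>p\<in>F - {r}. {fst p<..<snd p})"
      using sub by (simp only: UN_insert Un_absorb1)
    then have eq: "(\<Union>p\<in>F. {fst p<..<snd p}) = (\<Union>p\<in>F - {r}. {fst p<..<snd p})"
      by (simp only: F[symmetric])
    have "F - {r} \<subset> F" using r by auto
    from psubset.IH[OF this] obtain G where G: "G \<subseteq> F - {r}"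
      "(\<Union>p\<in>G. {fst p<..<snd p}) = (\<Union>p\<in>F - {r}. {fst p<..<snd p})"
      "\<forall>x. card {p \<in> G. x \<in> {fst p<..<snd p}} \<le> 2"
      by (elim exE conjE) (rule that)
    show ?thesis
      unfolding eq
    proof (intro exI conjI)
      show "G \<subseteq> F" using G(1) by auto
    qed (fact G)+
  qed
qed

lemma emeasure_Union_intervals_le_finite:
  fixes F :: "(real \<times> real) set"
  assumes [simp, measurable_cong]: "sets P = sets borel" "sets Q = sets borel" and "finite F"
    and le: "\<And>p. p \<in> F \<Longrightarrow> emeasure P {fst p<..<snd p} \<le> emeasure Q {fst p<..<snd p}"
  shows "emeasure P (\<Union>p\<in>F. {fst p<..<snd p}) \<le> 2 * emeasure Q UNIV"
proof -
  have [simp]: "space Q = UNIV"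
    using sets_eq_imp_space_eq[OF assms(2)] by simp
  obtain G where G: "G \<subseteq> F" "(\<Union>p\<in>G. {fst p<..<snd p}) = (\<Union>p\<in>F. {fst p<..<snd p})"
    "\<And>x. card {p \<in> G. x \<in> {fst p<..<snd p}} \<le> 2"
    using finite_intervals_overlap_two[OF \<open>finite F\<close>] by (elim exE conjE) (rule that, assumption+, rule spec)
  have [simp]: "finite G" using G(1) \<open>finite F\<close> finite_subset by blast
  have "emeasure P (\<Union>p\<in>F. {fst p<..<snd p}) \<le> (\<Sum>p\<in>G. emeasure P {fst p<..<snd p})"
    unfolding G(2)[symmetric] by (rule emeasure_subadditive_finite) auto
  also have "\<dots> \<le> (\<Sum>p\<in>G. emeasure Q {fst p<..<snd p})"
    using G(1) le by (intro sum_mono) blast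
  also have "\<dots> = (\<integral>\<^sup>+x. (\<Sum>p\<in>G. indicator {fst p<..<snd p} x) \<partial>Q)"
    by (subst nn_integral_sum) auto
  also have "\<dots> \<le> (\<integral>\<^sup>+x. 2 \<partial>Q)"
  proof (rule nn_integral_mono)
    fix x
    have "(\<Sum>p\<in>G. indicator {fst p<..<snd p} x) = (of_nat (card {p \<in> G. x \<in> {fst p<..<snd p}}) :: ennreal)"
      by (simp add: indicator_def sum.If_cases Int_def flip: of_bool_def)
    also have "\<dots> \<le> of_nat 2" using G(3) of_nat_mono by blast
    finally show "(\<Sum>p\<in>G. indicator {fst p<..<snd p} x) \<le> (2::ennreal)" by simp
  qed
  finally show ?thesis by simp
qed

text \<open>By Lindelof's theorem the union is that of a countable subfamily, hence an increasing limit of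
  finite unions; the bound for finite families does not depend on their size.\<close>

lemma emeasure_Union_intervals_le:
  fixes F :: "(real \<times> real) set"
  assumes sets: "sets P = sets borel" "sets Q = sets borel"
    and le: "\<And>p. p \<in> F \<Longrightarrow> emeasure P {fst p<..<snd p} \<le> emeasure Q {fst p<..<snd p}"
  shows "emeasure P (\<Union>p\<in>F. {fst p<..<snd p}) \<le> 2 * emeasure Q UNIV"
proof -
  let ?I = "\<lambda>p :: real \<times> real. {fst p<..<snd p}"
  obtain U where U: "U \<subseteq> ?I ` F" "countable U" "\<Union>U = \<Union>(?I ` F)"
  proof (rule Lindelof[of "?I ` F"])
    show "open S" if "S \<in> ?I ` F" for S using that by auto
  qed
  have "countable U \<and> U \<subseteq> ?I ` F" using U by simp
  then obtain F' where F': "countable F'" "F' \<subseteq> F" "U = ?I ` F'"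
    unfolding countable_subset_image by (elim exE conjE) (rule that)
  show ?thesis
  proof (cases "F' = {}")
    case True
    then show ?thesis using U F' by simp
  next
    case False
    define A where "A k = (\<Union>i\<le>k. ?I (from_nat_into F' i))" for k
    have "(\<Union>p\<in>F. ?I p) = (\<Union>k. A k)"
    proof -
      have "(\<Union>p\<in>F. ?I p) = (\<Union>p\<in>range (from_nat_into F'). ?I p)"
        using U F' False by (simp add: range_from_nat_into)
      also have "\<dots> = (\<Union>k. A k)" unfolding A_def by fastforce
      finally show ?thesis .
    qed
    moreover have "emeasure P (\<Union>k. A k) = (SUP k. emeasure P (A k))"
    proof (rule SUP_emeasure_incseq[symmetric])
      show "range A \<subseteq> sets P" by (auto simp: A_def sets)
      show "incseq A" unfolding incseq_def A_def by (intro allI impI UN_mono) auto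
    qed
    moreover have "emeasure P (A k) \<le> 2 * emeasure Q UNIV" for k
    proof -
      have Ak: "A k = (\<Union>p\<in>from_nat_into F' ` {..k}. ?I p)" by (simp add: A_def)
      have "from_nat_into F' ` {..k} \<subseteq> F"
        using F'(2) from_nat_into[OF False] by blast
      then show ?thesis
        unfolding Ak by (intro emeasure_Union_intervals_le_finite[OF sets] le) auto
    qed
    ultimately show ?thesis by (simp add: SUP_least)
  qed
qed

section \<open>Averages over balls and over intervals of radii\<close>

lemma dist_ray_power2:
  fixes x \<theta> :: "'a::real_inner"
  assumes "norm \<theta> = 1"
  shows "(dist x (t *\<^sub>R \<theta>))\<^sup>2 = t\<^sup>2 - 2 * t * (x \<bullet> \<theta>) + (norm x)\<^sup>2"
proof -
  have "\<theta> \<bullet> \<theta> = 1" using assms by (simp add: dot_square_norm)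
  then show ?thesis
    unfolding dist_norm power2_norm_eq_inner
    by (simp add: inner_diff_left inner_diff_right inner_commute algebra_simps power2_eq_square)
qed

text \<open>Beyond the radius \<open>\<bar>x\<bar>\<close> the distance to \<open>x\<close> grows along every ray, so nothing is added there.
  Below it, if \<open>\<bar>x\<bar> \<le> R\<close>, the added points have norm at most \<open>R\<close>.  If \<open>R < \<bar>x\<bar>\<close>, let
  \<open>s\<^sup>2 = \<bar>x\<bar>\<^sup>2 - R\<^sup>2\<close>.  The power of the origin with respect to the ball is \<open>s\<^sup>2\<close>, so the two
  endpoints of the intersection have product \<open>s\<^sup>2\<close> and the radius \<open>s\<close> itself lies in the ball.
  The added points therefore have radii between \<open>s\<close> and \<open>\<bar>x\<bar>\<close>, and lie in the tangent cone of the
  ball; this truncated sector fits into the ball of radius \<open>R\<close> around \<open>(s/\<bar>x\<bar>) x\<close>.\<close>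

lemma ray_ball_hull:
  fixes x \<theta> :: "'a::real_inner"
  assumes \<theta>: "norm \<theta> = 1" and "u \<ge> 0" and u: "u *\<^sub>R \<theta> \<in> ball x R"
    and t: "min u (norm x) \<le> t" "t \<le> max u (norm x)"
  shows "t *\<^sub>R \<theta> \<in> ball x R \<union>
    cball (if norm x \<le> R then 0 else (sqrt ((norm x)\<^sup>2 - R\<^sup>2) / norm x) *\<^sub>R x) R"
proof -
  define r where "r = norm x"
  define c where "c = x \<bullet> \<theta>"
  have R: "R > 0" using u by (auto intro: le_less_trans[OF zero_le_dist])
  have "r \<ge> 0" by (simp add: r_def)
  have "c \<le> r" using norm_cauchy_schwarz[of x \<theta>] \<theta> by (simp add: c_def r_def)
  have in_ball: "v *\<^sub>R \<theta> \<in> ball x R \<longleftrightarrow> v\<^sup>2 - 2 * v * c + r\<^sup>2 < R\<^sup>2" for v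
    using dist_ray_power2[OF \<theta>, of x v] R power_strict_mono[of "dist x (v *\<^sub>R \<theta>)" R 2]
      power_less_imp_less_base[of "dist x (v *\<^sub>R \<theta>)" 2 R]
    by (auto simp: c_def r_def)
  have u': "u\<^sup>2 - 2 * u * c + r\<^sup>2 < R\<^sup>2" using u in_ball by simp
  consider (out) "r \<le> u" | (big) "u < r" "r \<le> R" | (small) "u < r" "R < r" by linarith
  then show ?thesis
  proof cases
    case out
    then have "r \<le> t" "t \<le> u" using t by (auto simp: r_def)
    then have "0 \<le> (u - t) * (u + t - 2 * c)" using \<open>c \<le> r\<close> by (intro mult_nonneg_nonneg) auto
    then have "t\<^sup>2 - 2 * t * c \<le> u\<^sup>2 - 2 * u * c" by (simp add: algebra_simps power2_eq_square)
    with u' in_ball[of t] show ?thesis by simp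
  next
    case big
    then have "0 \<le> t" "t \<le> R" using t \<open>u \<ge> 0\<close> by (auto simp: r_def)
    with \<theta> big show ?thesis by (simp add: r_def)
  next
    case small
    define s where "s = sqrt (r\<^sup>2 - R\<^sup>2)"
    have "R\<^sup>2 < r\<^sup>2" using small R by (simp add: power_strict_mono)
    then have s: "s > 0" "s\<^sup>2 = r\<^sup>2 - R\<^sup>2" by (simp_all add: s_def)
    have "s\<^sup>2 \<le> r\<^sup>2" using s by simp
    then have "s \<le> r" using \<open>r \<ge> 0\<close> by (rule power2_le_imp_le)
    have ut: "u \<le> t" "t \<le> r" using t small by (auto simp: r_def)
    have quad: "u\<^sup>2 - 2 * u * c + s\<^sup>2 < 0" using u' s by simp
    have "u > 0" using quad \<open>u \<ge> 0\<close> s(1) by (cases "u = 0") auto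
    \<comment> \<open>The ray lies inside the tangent cone, whose half-angle has cosine \<open>s / r\<close>.\<close>
    have "s < c"
    proof -
      have "2 * u * s \<le> u\<^sup>2 + s\<^sup>2" using zero_le_power2[of "u - s"] by (simp add: power2_diff)
      with quad have "2 * u * s < 2 * u * c" by linarith
      with \<open>u > 0\<close> show ?thesis by simp
    qed
    show ?thesis
    proof (cases "t \<le> s")
      case True
      \<comment> \<open>The difference between \<open>t\<close> times the value of the quadratic at \<open>u\<close> and \<open>u\<close> times its
        value at \<open>t\<close> is \<open>(t - u) (s\<^sup>2 - u t)\<close>.\<close>
      have "u * (t\<^sup>2 - 2 * t * c + s\<^sup>2) < 0"
      proof -
        have "0 \<le> (t - u) * (s\<^sup>2 - u * t)"
        proof (intro mult_nonneg_nonneg)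
          have "u * t \<le> s * s" using ut True \<open>u > 0\<close> by (intro mult_mono) auto
          then show "0 \<le> s\<^sup>2 - u * t" by (simp add: power2_eq_square)
        qed (use ut in auto)
        moreover have "t * (u\<^sup>2 - 2 * u * c + s\<^sup>2) < 0"
          using quad ut \<open>u > 0\<close> by (intro mult_pos_neg) auto
        ultimately show ?thesis by (simp add: algebra_simps power2_eq_square)
      qed
      then have "t\<^sup>2 - 2 * t * c + s\<^sup>2 < 0" using \<open>u > 0\<close> by (simp add: mult_less_0_iff)
      with s in_ball[of t] show ?thesis by simp
    next
      case False
      have "r > 0" using s \<open>s \<le> r\<close> by simp
      have "(dist ((s / r) *\<^sub>R x) (t *\<^sub>R \<theta>))\<^sup>2 = t\<^sup>2 - 2 * t * (s / r * c) + s\<^sup>2"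
        using \<open>r > 0\<close> s(1) by (simp add: dist_ray_power2[OF \<theta>] c_def r_def)
      also have "\<dots> \<le> t\<^sup>2 - 2 * t * (s / r * s) + s\<^sup>2"
        using False s \<open>s < c\<close> \<open>r > 0\<close> by (simp add: mult_left_mono divide_right_mono)
      also have "\<dots> = R\<^sup>2 + (t - r) * (t + r - 2 * s * (s / r))"
      proof -
        have R2: "R\<^sup>2 = r\<^sup>2 - s\<^sup>2" using s by linarith
        show ?thesis unfolding R2
          using \<open>r > 0\<close> by (simp add: field_simps power2_eq_square)
      qed
      finally have d: "(dist ((s / r) *\<^sub>R x) (t *\<^sub>R \<theta>))\<^sup>2 \<le> R\<^sup>2 + (t - r) * (t + r - 2 * s * (s / r))" .
      have "(t - r) * (t + r - 2 * s * (s / r)) \<le> 0"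
      proof (rule mult_nonpos_nonneg)
        have "s * (s / r) \<le> s * 1" using s \<open>r > 0\<close> \<open>s \<le> r\<close> by (intro mult_left_mono) auto
        then show "0 \<le> t + r - 2 * s * (s / r)" using False \<open>s \<le> r\<close> by simp
      qed (use ut in simp)
      with d have "(dist ((s / r) *\<^sub>R x) (t *\<^sub>R \<theta>))\<^sup>2 \<le> R\<^sup>2" by linarith
      then have "dist ((s / r) *\<^sub>R x) (t *\<^sub>R \<theta>) \<le> R" using R by (rule power2_le_imp_le[OF _ less_imp_le])
      with small show ?thesis by (simp add: r_def s_def)
    qed
  qed
qed

text \<open>The radial maximal function is at most twice the uncentered maximal function of the profile.
  The bound \<open>avg\<close> is applied on each ray to the radii between \<open>\<bar>x\<bar>\<close> and the points of the ball;
  together these segments have volume at most that of two balls of radius \<open>R\<close>.\<close>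

lemma nn_integral_radial_ball_le:
  fixes x :: "'a::euclidean_space" and T :: ennreal
  assumes [measurable]: "g \<in> borel_measurable borel" and "R > 0"
    and avg: "\<And>I. \<lbrakk>is_interval I; bounded I; I \<subseteq> {0..}; norm x \<in> I\<rbrakk> \<Longrightarrow>
      (\<integral>\<^sup>+t\<in>I. g t \<partial>radial_measure DIM('a)) \<le> T * emeasure (radial_measure DIM('a)) I"
  shows "(\<integral>\<^sup>+y\<in>ball x R. g (norm y) \<partial>lborel) \<le> 2 * T * emeasure lborel (ball x R)"
proof -
  let ?\<mu> = "radial_measure DIM('a)"
  define q where "q = (if norm x \<le> R then 0 else (sqrt ((norm x)\<^sup>2 - R\<^sup>2) / norm x) *\<^sub>R x)"
  define E where "E = ball x R \<union> cball q R"
  have [measurable]: "E \<in> sets borel" "ball x R \<in> sets borel" by (simp_all add: E_def)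
  have nonneg: "AE t in ?\<mu>. 0 \<le> t"
    by (simp add: AE_radial_measure_iff)
  have ray: "(\<integral>\<^sup>+t. g (norm (t *\<^sub>R \<theta>)) * indicator (ball x R) (t *\<^sub>R \<theta>) \<partial>?\<mu>) \<le>
      T * (\<integral>\<^sup>+t. indicator E (t *\<^sub>R \<theta>) \<partial>?\<mu>)" if "norm \<theta> = 1" for \<theta> :: 'a
  proof (cases "\<exists>u\<ge>0. u *\<^sub>R \<theta> \<in> ball x R")
    case False
    from nonneg have "AE t in ?\<mu>. g (norm (t *\<^sub>R \<theta>)) * indicator (ball x R) (t *\<^sub>R \<theta>) = 0"
      by eventually_elim (use False in \<open>auto simp: indicator_def\<close>)
    then have "(\<integral>\<^sup>+t. g (norm (t *\<^sub>R \<theta>)) * indicator (ball x R) (t *\<^sub>R \<theta>) \<partial>?\<mu>) = (\<integral>\<^sup>+t. 0 \<partial>?\<mu>)"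
      by (rule nn_integral_cong_AE)
    then show ?thesis by simp
  next
    case True
    \<comment> \<open>The convex hull of \<open>norm x\<close> and the radii at which the ray lies in the ball, written as a
      union of segments that all end at \<open>norm x\<close>.\<close>
    define I where "I = {t. \<exists>u\<ge>0. u *\<^sub>R \<theta> \<in> ball x R \<and> min u (norm x) \<le> t \<and> t \<le> max u (norm x)}"
    have subE: "t *\<^sub>R \<theta> \<in> E" if "t \<in> I" for t
      using that ray_ball_hull[OF \<open>norm \<theta> = 1\<close>, of _ x R t] by (auto simp: I_def E_def q_def)
    have nonnegI: "I \<subseteq> {0..}"
    proof
      fix t assume "t \<in> I"
      then obtain u where "u \<ge> 0" "min u (norm x) \<le> t" by (auto simp: I_def)
      moreover have "0 \<le> min u (norm x)" using \<open>u \<ge> 0\<close> by simp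
      ultimately show "t \<in> {0..}" unfolding atLeast_iff by linarith
    qed
    have "norm x \<in> I" using True by (auto simp: I_def)
    have "is_interval I"
      unfolding is_interval_1
    proof (intro ballI allI impI)
      fix a b t assume ab: "a \<in> I" "b \<in> I" and "a \<le> t \<and> t \<le> b"
      then have t: "a \<le> t" "t \<le> b" by auto
      show "t \<in> I"
      proof (cases "t \<le> norm x")
        case True
        obtain u where "u \<ge> 0" "u *\<^sub>R \<theta> \<in> ball x R" "min u (norm x) \<le> a" "a \<le> max u (norm x)"
          using ab(1) by (auto simp: I_def)
        with t True show ?thesis by (auto simp: I_def intro!: exI[of _ u])
      next
        case False
        obtain u where "u \<ge> 0" "u *\<^sub>R \<theta> \<in> ball x R" "min u (norm x) \<le> b" "b \<le> max u (norm x)"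
          using ab(2) by (auto simp: I_def)
        with t False show ?thesis by (auto simp: I_def intro!: exI[of _ u])
      qed
    qed
    have "bounded E" by (simp add: E_def)
    then obtain B where B: "\<And>y. y \<in> E \<Longrightarrow> norm y \<le> B"
      unfolding bounded_iff by auto
    have "bounded I"
    proof (rule boundedI)
      fix t assume "t \<in> I"
      then show "norm t \<le> B" using B[OF subE] \<open>norm \<theta> = 1\<close> by simp
    qed
    have [measurable]: "I \<in> sets borel"
      by (rule real_interval_borel_measurable) fact
    have "(\<integral>\<^sup>+t. g (norm (t *\<^sub>R \<theta>)) * indicator (ball x R) (t *\<^sub>R \<theta>) \<partial>?\<mu>) \<le> (\<integral>\<^sup>+t\<in>I. g t \<partial>?\<mu>)"
    proof (rule nn_integral_mono_AE, use nonneg in eventually_elim)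
      fix t :: real assume "0 \<le> t"
      then have "t \<in> I" if "t *\<^sub>R \<theta> \<in> ball x R"
        unfolding I_def mem_Collect_eq by (intro exI[of _ t]) (use that in simp)
      with \<open>0 \<le> t\<close> show "g (norm (t *\<^sub>R \<theta>)) * indicator (ball x R) (t *\<^sub>R \<theta>) \<le> g t * indicator I t"
        using \<open>norm \<theta> = 1\<close> by (auto simp: indicator_def)
    qed
    moreover have "emeasure ?\<mu> I \<le> (\<integral>\<^sup>+t. indicator E (t *\<^sub>R \<theta>) \<partial>?\<mu>)"
    proof -
      have "emeasure ?\<mu> I = (\<integral>\<^sup>+t. indicator I t \<partial>?\<mu>)" by simp
      also have "\<dots> \<le> (\<integral>\<^sup>+t. indicator E (t *\<^sub>R \<theta>) \<partial>?\<mu>)"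
        by (rule nn_integral_mono) (auto simp: indicator_def subE)
      finally show ?thesis .
    qed
    ultimately show ?thesis
      using avg[OF \<open>is_interval I\<close> \<open>bounded I\<close> nonnegI \<open>norm x \<in> I\<close>]
      by (meson mult_left_mono order_trans zero_le)
  qed
  have "sigma_finite_measure ?\<mu>" by (simp add: sigma_finite_radial_measure)
  then interpret \<mu>: sigma_finite_measure ?\<mu> .
  have "(\<integral>\<^sup>+y\<in>ball x R. g (norm y) \<partial>lborel) =
      (\<integral>\<^sup>+\<theta>. \<integral>\<^sup>+t. g (norm (t *\<^sub>R \<theta>)) * indicator (ball x R) (t *\<^sub>R \<theta>) \<partial>?\<mu> \<partial>direction_measure)"
    by (rule nn_integral_polar) measurable
  also have "\<dots> \<le> (\<integral>\<^sup>+\<theta>. T * (\<integral>\<^sup>+t. indicator E (t *\<^sub>R \<theta>) \<partial>?\<mu>) \<partial>direction_measure)"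
    by (rule nn_integral_mono_AE, use AE_direction_measure_norm in eventually_elim) (rule ray)
  also have "\<dots> = T * (\<integral>\<^sup>+\<theta>. (\<integral>\<^sup>+t. indicator E (t *\<^sub>R \<theta>) \<partial>?\<mu>) \<partial>direction_measure)"
    by (rule nn_integral_cmult) measurable
  also have "(\<integral>\<^sup>+\<theta>. (\<integral>\<^sup>+t. indicator E (t *\<^sub>R \<theta>) \<partial>?\<mu>) \<partial>direction_measure) = emeasure lborel E"
    by (subst nn_integral_polar[symmetric]) auto
  also have "emeasure lborel E \<le> emeasure lborel (ball x R) + emeasure lborel (cball q R)"
    unfolding E_def by (rule emeasure_subadditive) auto
  also have "emeasure lborel (cball q R) = emeasure lborel (ball x R)"
    using \<open>R > 0\<close> by (simp add: emeasure_cball emeasure_ball)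
  finally show ?thesis
    by (simp add: mult_left_mono mult_2 distrib_left distrib_right)
qed

lemma emeasure_radial_measure_bounded:
  assumes "n > 0" "bounded I"
  shows "emeasure (radial_measure n) I < \<infinity>"
proof -
  obtain b where "I \<subseteq> {..b}"
    using bounded_imp_bdd_above[OF assms(2)] by (auto simp: bdd_above_def)
  then have "emeasure (radial_measure n) I \<le> emeasure (radial_measure n) {..b}"
    by (intro emeasure_mono) auto
  also have "\<dots> < \<infinity>" using assms(1) by (simp add: emeasure_radial_measure_atMost)
  finally show ?thesis .
qed

text \<open>Open intervals are needed for covering arguments.  Since \<open>\<mu>\<close> has no atoms, slightly larger open
  intervals have almost the same mass, and a strict inequality leaves room for this.\<close>

lemma interval_average_thicken:
  assumes "n > 0" and [measurable]: "g \<in> borel_measurable borel"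
    and I: "is_interval I" "bounded I" "r \<in> I" and "T < \<infinity>"
    and gt: "T * emeasure (radial_measure n) I < (\<integral>\<^sup>+t\<in>I. g t \<partial>radial_measure n)"
  obtains a b where "r \<in> {a<..<b}"
    "T * emeasure (radial_measure n) {a<..<b} < (\<integral>\<^sup>+t\<in>{a<..<b}. g t \<partial>radial_measure n)"
proof -
  let ?\<mu> = "radial_measure n"
  define a where "a = Inf I"
  define b where "b = Sup I"
  have bdd: "bdd_above I" "bdd_below I"
    using I(2) by (simp_all add: bounded_imp_bdd_above bounded_imp_bdd_below)
  have sub: "I \<subseteq> {a..b}"
    using bdd by (auto simp: a_def b_def cInf_lower cSup_upper)
  have sup: "{a..b} \<subseteq> I \<union> {a, b}"
  proof
    fix t assume t: "t \<in> {a..b}"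
    show "t \<in> I \<union> {a, b}"
    proof (rule ccontr)
      assume nt: "t \<notin> I \<union> {a, b}"
      with t have "Inf I < t" "t < Sup I" by (auto simp: a_def b_def)
      then obtain y z where "y \<in> I" "y < t" "z \<in> I" "t < z"
        using bdd I(3) by (metis cInf_lessD empty_iff less_cSupD)
      then have "t \<in> I" using I(1) unfolding is_interval_1 by (meson less_imp_le)
      with nt show False by simp
    qed
  qed
  have [measurable]: "I \<in> sets borel" using I(1) by (rule real_interval_borel_measurable)
  have null: "emeasure ?\<mu> {c} = 0" for c
    unfolding radial_measure_def by (subst emeasure_density) (auto intro!: nn_integral_null_set)
  have "emeasure ?\<mu> {a..b} \<le> emeasure ?\<mu> (I \<union> ({a} \<union> {b}))"
    using sup by (intro emeasure_mono) auto
  also have "\<dots> \<le> emeasure ?\<mu> I + (emeasure ?\<mu> {a} + emeasure ?\<mu> {b})"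
    by (intro order_trans[OF emeasure_subadditive] add_left_mono emeasure_subadditive) auto
  finally have le: "emeasure ?\<mu> {a..b} \<le> emeasure ?\<mu> I" by (simp add: null)
  define A where "A i = {a - 1 / real (Suc i)<..<b + 1 / real (Suc i)}" for i
  have dec: "decseq A"
    unfolding decseq_Suc_iff
  proof (intro allI subsetI)
    fix i t assume "t \<in> A (Suc i)"
    moreover have "1 / real (Suc (Suc i)) \<le> 1 / real (Suc i)" by (intro divide_left_mono) auto
    ultimately show "t \<in> A i"
      unfolding A_def greaterThanLessThan_iff by linarith
  qed
  have in_A: "t \<in> A i" if "a \<le> t" "t \<le> b" for t i
  proof -
    have "0 < 1 / real (Suc i)" by simp
    with that show ?thesis unfolding A_def greaterThanLessThan_iff by linarith
  qed
  have "(\<Inter>i. A i) = {a..b}"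
  proof
    show "{a..b} \<subseteq> (\<Inter>i. A i)"
      using in_A by auto
    show "(\<Inter>i. A i) \<subseteq> {a..b}"
    proof
      fix t assume t: "t \<in> (\<Inter>i. A i)"
      have lim: "(\<lambda>i. 1 / real (Suc i)) \<longlonglongrightarrow> 0"
        using LIMSEQ_inverse_real_of_nat by (simp add: inverse_eq_divide)
      have "(\<lambda>i. a - 1 / real (Suc i)) \<longlonglongrightarrow> a - 0" "(\<lambda>i. b + 1 / real (Suc i)) \<longlonglongrightarrow> b + 0"
        by (intro tendsto_intros lim)+
      then have "a - 0 \<le> t" "t \<le> b + 0"
        using t by (auto simp: A_def intro: less_imp_le LIMSEQ_le_const LIMSEQ_le_const2)
      then show "t \<in> {a..b}" by simp
    qed
  qed
  moreover have "(\<lambda>i. emeasure ?\<mu> (A i)) \<longlonglongrightarrow> emeasure ?\<mu> (\<Inter>i. A i)"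
  proof (rule Lim_emeasure_decseq[OF _ dec])
    show "emeasure ?\<mu> (A i) \<noteq> \<infinity>" for i
      using emeasure_radial_measure_bounded[OF \<open>n > 0\<close>, of "A i"] by (simp add: A_def)
  qed (auto simp: A_def)
  ultimately have "(\<lambda>i. T * emeasure ?\<mu> (A i)) \<longlonglongrightarrow> T * emeasure ?\<mu> {a..b}"
    using \<open>T < \<infinity>\<close> by (intro ennreal_tendsto_cmult) auto
  moreover have "T * emeasure ?\<mu> {a..b} < (\<integral>\<^sup>+t\<in>I. g t \<partial>?\<mu>)"
    using gt mult_left_mono[OF le, of T] by (auto intro: le_less_trans)
  ultimately have "eventually (\<lambda>i. T * emeasure ?\<mu> (A i) < (\<integral>\<^sup>+t\<in>I. g t \<partial>?\<mu>)) sequentially"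
    by (rule order_tendstoD(2))
  then obtain i where i: "T * emeasure ?\<mu> (A i) < (\<integral>\<^sup>+t\<in>I. g t \<partial>?\<mu>)"
    by (auto simp: eventually_sequentially)
  have IA: "I \<subseteq> A i"
    using sub in_A by auto
  have "(\<integral>\<^sup>+t\<in>I. g t \<partial>?\<mu>) \<le> (\<integral>\<^sup>+t\<in>A i. g t \<partial>?\<mu>)"
    using IA by (intro nn_integral_mono) (auto simp: indicator_def)
  with i have "T * emeasure ?\<mu> (A i) < (\<integral>\<^sup>+t\<in>A i. g t \<partial>?\<mu>)" by (rule less_le_trans)
  with IA I(3) show ?thesis unfolding A_def by (intro that) auto
qed

section \<open>The weak type inequality\<close>

text \<open>The \<open>A\<^sub>1\<close> condition without quotients and for a Borel version of the profile.  Its two integrals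
  acquire the same factor \<open>n\<close> when \<open>t\<^sup>n\<^sup>-\<^sup>1 dt\<close> is replaced by \<open>\<mu>\<close>.\<close>

lemma A1_const_interval_le:
  fixes w\<^sub>0 w :: "real \<Rightarrow> ennreal"
  assumes "n > 0" and A1: "A1_const n w\<^sub>0 < ennreal C"
    and [measurable]: "w \<in> borel_measurable borel"
    and w: "AE t in lborel. 0 \<le> t \<longrightarrow> w\<^sub>0 t = w t"
    and I: "is_interval I" "bounded I" "I \<subseteq> {0..}"
    and pos: "emeasure (radial_measure n) I \<noteq> 0"
  shows "(\<integral>\<^sup>+t\<in>I. w t \<partial>radial_measure n) \<le> ennreal C * ess_inf_on I w\<^sub>0 * emeasure (radial_measure n) I"
proof -
  have [measurable]: "I \<in> sets borel" using I(1) by (rule real_interval_borel_measurable)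
  let ?A = "\<integral>\<^sup>+t\<in>I. w\<^sub>0 t * ennreal (t ^ (n - 1)) \<partial>lebesgue"
  let ?B = "\<integral>\<^sup>+t\<in>I. ennreal (t ^ (n - 1)) \<partial>lebesgue"
  obtain C0 where "ennreal C0 < ennreal C"
    and C0: "\<And>I. radial_interval I \<Longrightarrow>
       (\<integral>\<^sup>+t\<in>I. w\<^sub>0 t * ennreal (t ^ (n - 1)) \<partial>lebesgue) / (\<integral>\<^sup>+t\<in>I. ennreal (t ^ (n - 1)) \<partial>lebesgue)
       \<le> ennreal C0 * ess_inf_on I w\<^sub>0"
    using A1 unfolding A1_const_def Inf_less_iff by auto
  have "emeasure lborel I \<noteq> 0"
  proof
    assume "emeasure lborel I = 0"
    then have "I \<in> null_sets lborel" by auto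
    then have "emeasure (radial_measure n) I = 0"
      unfolding radial_measure_def by (subst emeasure_density) (auto intro: nn_integral_null_set)
    with pos show False by simp
  qed
  then have "radial_interval I"
    using I by (simp add: radial_interval_def zero_less_iff_neq_zero)
  from C0[OF this] have AB: "?A / ?B \<le> ennreal C * ess_inf_on I w\<^sub>0"
    using \<open>ennreal C0 < ennreal C\<close> by (meson less_imp_le mult_right_mono order_trans zero_le)
  have dens: "(\<integral>\<^sup>+t\<in>I. h t \<partial>radial_measure n) = ennreal (real n) * (\<integral>\<^sup>+t\<in>I. h t * ennreal (t ^ (n - 1)) \<partial>lebesgue)"
    if [measurable]: "h \<in> borel_measurable borel" for h
  proof -
    have "(\<integral>\<^sup>+t\<in>I. h t \<partial>radial_measure n) =
        (\<integral>\<^sup>+t. ennreal (real n) * (h t * ennreal (t ^ (n - 1)) * indicator I t) \<partial>lborel)"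
      unfolding radial_measure_def using I(3)
      by (subst nn_integral_density)
         (auto intro!: nn_integral_cong simp: indicator_def ennreal_mult' mult_ac)
    also have "\<dots> = ennreal (real n) * (\<integral>\<^sup>+t\<in>I. h t * ennreal (t ^ (n - 1)) \<partial>lborel)"
      by (rule nn_integral_cmult) measurable
    finally show ?thesis by (simp add: nn_integral_completion)
  qed
  have A: "(\<integral>\<^sup>+t\<in>I. w t \<partial>radial_measure n) = ennreal (real n) * ?A"
  proof -
    have "(\<integral>\<^sup>+t\<in>I. w t * ennreal (t ^ (n - 1)) \<partial>lborel) = (\<integral>\<^sup>+t\<in>I. w\<^sub>0 t * ennreal (t ^ (n - 1)) \<partial>lborel)"
      using w by (intro nn_integral_cong_AE; eventually_elim) (use I(3) in \<open>auto simp: indicator_def\<close>)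
    then show ?thesis by (simp add: dens nn_integral_completion)
  qed
  have B: "emeasure (radial_measure n) I = ennreal (real n) * ?B"
    using dens[of "\<lambda>_. 1"] by simp
  have "?B \<noteq> 0" using pos B by auto
  have "?B \<noteq> \<infinity>"
    using emeasure_radial_measure_bounded[OF \<open>n > 0\<close> I(2)] B \<open>n > 0\<close> by (auto simp: ennreal_mult_eq_top_iff)
  have "?A = ?A / ?B * ?B"
    using \<open>?B \<noteq> 0\<close> \<open>?B \<noteq> \<infinity>\<close> by (simp add: ennreal_divide_times ennreal_divide_self less_top[symmetric] del: One_nat_def)
  also have "\<dots> \<le> ennreal C * ess_inf_on I w\<^sub>0 * ?B"
    using AB by (rule mult_right_mono) simp
  finally have "ennreal (real n) * ?A \<le> ennreal (real n) * (ennreal C * ess_inf_on I w\<^sub>0 * ?B)"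
    by (rule mult_left_mono) simp
  then show ?thesis unfolding A B by (simp add: mult_ac)
qed

lemma ess_inf_mult_nn_integral_le:
  fixes w\<^sub>0 w :: "real \<Rightarrow> ennreal"
  assumes "n > 0" and [measurable]: "w \<in> borel_measurable borel" "g \<in> borel_measurable borel"
    and w: "AE t in lborel. 0 \<le> t \<longrightarrow> w\<^sub>0 t = w t"
    and [measurable]: "I \<in> sets borel"
  shows "ess_inf_on I w\<^sub>0 * (\<integral>\<^sup>+t\<in>I. g t \<partial>radial_measure n) \<le> (\<integral>\<^sup>+t\<in>I. g t * w t \<partial>radial_measure n)"
  unfolding ess_inf_on_def SUP_mult_right_ennreal[of "\<lambda>z. z" for z, simplified]
proof (rule Sup_least, safe)
  fix z assume "AE t\<in>I in lebesgue. z \<le> w\<^sub>0 t"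
  then have "AE t\<in>I in lborel. z \<le> w\<^sub>0 t" by (simp add: AE_completion_iff)
  with w have "AE t in lborel. 0 \<le> t \<longrightarrow> (t \<in> I \<longrightarrow> z \<le> w t)"
    by eventually_elim auto
  then have ae: "AE t in radial_measure n. t \<in> I \<longrightarrow> z \<le> w t"
    using \<open>n > 0\<close> by (simp add: AE_radial_measure_iff)
  have "z * (\<integral>\<^sup>+t\<in>I. g t \<partial>radial_measure n) = (\<integral>\<^sup>+t. z * (g t * indicator I t) \<partial>radial_measure n)"
    by (rule nn_integral_cmult[symmetric]) measurable
  also have "\<dots> \<le> (\<integral>\<^sup>+t\<in>I. g t * w t \<partial>radial_measure n)"
    using ae by (intro nn_integral_mono_AE; eventually_elim) (auto simp: indicator_def mult.commute[of z] intro!: mult_left_mono)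
  finally show "z * (\<integral>\<^sup>+t\<in>I. g t \<partial>radial_measure n) \<le> (\<integral>\<^sup>+t\<in>I. g t * w t \<partial>radial_measure n)" .
qed

text \<open>The weighted weak type estimate for the uncentered maximal function on the half-line: the chain of
  inequalities for one interval compares the measures \<open>T w \<mu>\<close> and \<open>C g w \<mu>\<close>, and the overlap bound
  transfers this to the union.\<close>

lemma A1_weak_type_intervals:
  fixes w\<^sub>0 w g :: "real \<Rightarrow> ennreal" and F :: "(real \<times> real) set"
  assumes "n > 0" and A1: "A1_const n w\<^sub>0 < ennreal C"
    and [measurable]: "w \<in> borel_measurable borel" "g \<in> borel_measurable borel"
    and w: "AE t in lborel. 0 \<le> t \<longrightarrow> w\<^sub>0 t = w t"
    and F: "\<And>p. p \<in> F \<Longrightarrow> T * emeasure (radial_measure n) {fst p<..<snd p} <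
       (\<integral>\<^sup>+t\<in>{fst p<..<snd p}. g t \<partial>radial_measure n)"
  shows "T * (\<integral>\<^sup>+t\<in>(\<Union>p\<in>F. {fst p<..<snd p}). w t \<partial>radial_measure n) \<le>
    2 * (ennreal C * (\<integral>\<^sup>+t. g t * w t \<partial>radial_measure n))"
proof -
  let ?\<mu> = "radial_measure n"
  let ?O = "\<Union>p\<in>F. {fst p<..<snd p}"
  define P where "P = density ?\<mu> (\<lambda>t. T * w t)"
  define Q where "Q = density ?\<mu> (\<lambda>t. ennreal C * (g t * w t))"
  have [measurable]: "?O \<in> sets borel" by (intro borel_open open_UN ballI open_greaterThanLessThan)
  have P: "emeasure P S = T * (\<integral>\<^sup>+t\<in>S. w t \<partial>?\<mu>)" if [measurable]: "S \<in> sets borel" for S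
    unfolding P_def by (subst emeasure_density) (auto simp: mult.assoc nn_integral_cmult)
  have Q: "emeasure Q S = ennreal C * (\<integral>\<^sup>+t\<in>S. g t * w t \<partial>?\<mu>)" if [measurable]: "S \<in> sets borel" for S
    unfolding Q_def by (subst emeasure_density) (auto simp: mult.assoc nn_integral_cmult)
  have nonneg: "AE t in ?\<mu>. 0 \<le> t" using \<open>n > 0\<close> by (simp add: AE_radial_measure_iff)
  have "emeasure P ?O \<le> 2 * emeasure Q UNIV"
  proof (rule emeasure_Union_intervals_le)
    fix p assume "p \<in> F"
    define J where "J = {fst p<..<snd p}"
    \<comment> \<open>The \<open>A\<^sub>1\<close> condition speaks of intervals in \<open>[0,\<infinity>)\<close>; the rest of \<open>J\<close> is a null set.\<close>
    define I where "I = J \<inter> {0..}"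
    have [measurable]: "J \<in> sets borel" "I \<in> sets borel" by (simp_all add: J_def I_def)
    have I: "is_interval I" "bounded I" "I \<subseteq> {0..}"
      by (auto simp: I_def J_def is_interval_1 intro: bounded_Int)
    have JI: "(\<integral>\<^sup>+t\<in>J. h t \<partial>?\<mu>) = (\<integral>\<^sup>+t\<in>I. h t \<partial>?\<mu>)" for h
      by (rule nn_integral_cong_AE, use nonneg in eventually_elim) (auto simp: I_def indicator_def)
    have "emeasure ?\<mu> J = emeasure ?\<mu> I" using JI[of "\<lambda>_. 1"] by simp
    with F[OF \<open>p \<in> F\<close>] have gt: "T * emeasure ?\<mu> I < (\<integral>\<^sup>+t\<in>I. g t \<partial>?\<mu>)"
      using JI[of g] unfolding J_def[symmetric] by simp
    have "emeasure ?\<mu> I \<noteq> 0"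
    proof
      assume "emeasure ?\<mu> I = 0"
      then have "(\<integral>\<^sup>+t\<in>I. g t \<partial>?\<mu>) = 0" by (intro nn_integral_null_set) auto
      with gt show False by simp
    qed
    from A1_const_interval_le[OF \<open>n > 0\<close> A1 _ w I this]
    have "T * (\<integral>\<^sup>+t\<in>I. w t \<partial>?\<mu>) \<le> T * (ennreal C * ess_inf_on I w\<^sub>0 * emeasure ?\<mu> I)"
      by (intro mult_left_mono) auto
    also have "\<dots> = ennreal C * ess_inf_on I w\<^sub>0 * (T * emeasure ?\<mu> I)" by (simp add: mult_ac)
    also have "\<dots> \<le> ennreal C * ess_inf_on I w\<^sub>0 * (\<integral>\<^sup>+t\<in>I. g t \<partial>?\<mu>)"
      using gt by (intro mult_left_mono) auto
    also have "\<dots> = ennreal C * (ess_inf_on I w\<^sub>0 * (\<integral>\<^sup>+t\<in>I. g t \<partial>?\<mu>))" by (simp add: mult_ac)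
    also have "\<dots> \<le> ennreal C * (\<integral>\<^sup>+t\<in>I. g t * w t \<partial>?\<mu>)"
      using ess_inf_mult_nn_integral_le[OF \<open>n > 0\<close> _ _ w, of g I] by (intro mult_left_mono) auto
    finally show "emeasure P {fst p<..<snd p} \<le> emeasure Q {fst p<..<snd p}"
      unfolding J_def[symmetric] by (simp add: P Q JI)
  qed (simp_all add: P_def Q_def)
  then show ?thesis by (simp add: P Q)
qed

lemma borel_measurable_locally_integrable:
  fixes f :: "'a::euclidean_space \<Rightarrow> 'b::{banach, second_countable_topology}"
  assumes "locally_integrable f"
  shows "f \<in> borel_measurable lebesgue"
proof (rule borel_measurable_LIMSEQ_metric)
  fix i :: nat
  have "set_integrable lebesgue (cball 0 (real i)) f"
    using assms by (simp add: locally_integrable_def)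
  then show "(\<lambda>x. indicator (cball 0 (real i)) x *\<^sub>R f x) \<in> borel_measurable lebesgue"
    unfolding set_integrable_def by (rule borel_measurable_integrable)
next
  fix x :: 'a
  obtain k :: nat where k: "norm x \<le> real k" using real_arch_simple by blast
  have "eventually (\<lambda>i. indicator (cball 0 (real i)) x *\<^sub>R f x = f x) sequentially"
    using eventually_ge_at_top[of k] by eventually_elim (use k in \<open>auto simp: indicator_def\<close>)
  then show "(\<lambda>i. indicator (cball 0 (real i)) x *\<^sub>R f x) \<longlonglongrightarrow> f x"
    by (rule tendsto_eventually)
qed

theorem theorem2p4:
  fixes w\<^sub>0 :: "real \<Rightarrow> ennreal" and N C lam :: real and f :: "real ^ 'n \<Rightarrow> complex"
  assumes "N > 0" and "C > 0"
    and "\<forall>n::nat. real n > N \<longrightarrow> A1_const n w\<^sub>0 < ennreal C"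
    and "real CARD('n) > N"
    and "weight (radial_extension w\<^sub>0 :: real ^ 'n \<Rightarrow> ennreal)"
    and "radial f" and "locally_integrable f"
    and "lam > 0"
  shows "weighted_measure (radial_extension w\<^sub>0) {x. maximal_op f x > ennreal lam}
    \<le> ennreal (4 * C / lam) *
       (\<integral>\<^sup>+x. ennreal (norm (f x)) * radial_extension w\<^sub>0 x \<partial>lebesgue)"
proof -
  let ?n = "DIM(real ^ 'n)"
  let ?\<mu> = "radial_measure ?n"
  let ?\<omega> = "emeasure (direction_measure :: (real ^ 'n) measure) UNIV"
  have "?n > 0" by (rule DIM_positive)
  have A1: "A1_const ?n w\<^sub>0 < ennreal C" using assms(3,4) by simp
  obtain f\<^sub>0 where f: "f = radial_extension f\<^sub>0" using \<open>radial f\<close> by (auto simp: radial_def)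
  obtain w where [measurable]: "w \<in> borel_measurable borel"
    and w: "AE t in lborel. 0 \<le> t \<longrightarrow> w\<^sub>0 t = w t"
    using radial_borel_profile[where 'a="real ^ 'n"] assms(5) unfolding weight_def by blast
  have "radial_extension (\<lambda>t. ennreal (norm (f\<^sub>0 t))) \<in> borel_measurable (lebesgue :: (real ^ 'n) measure)"
    using borel_measurable_locally_integrable[OF assms(7)]
    by (simp add: f radial_extension_def[abs_def])
  then obtain g where [measurable]: "g \<in> borel_measurable borel"
    and g: "AE t in lborel. 0 \<le> t \<longrightarrow> ennreal (norm (f\<^sub>0 t)) = g t"
    by (rule radial_borel_profile)
  have w_norm: "AE x::real ^ 'n in lborel. radial_extension w\<^sub>0 x = w (norm x)"
    using AE_norm_lborel[OF w] by (simp add: radial_extension_def)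
  have g_norm: "AE x::real ^ 'n in lborel. ennreal (norm (f x)) = g (norm x)"
    using AE_norm_lborel[OF g] by (simp add: f radial_extension_def)
  \<comment> \<open>The threshold \<open>lam / 2\<close> absorbs the factor lost from balls to intervals.\<close>
  define F where "F = {p. ennreal (lam / 2) * emeasure ?\<mu> {fst p<..<snd p} < (\<integral>\<^sup>+t\<in>{fst p<..<snd p}. g t \<partial>?\<mu>)}"
  define U where "U = (\<Union>p\<in>F. {fst p<..<snd p})"
  have [measurable]: "U \<in> sets borel"
    unfolding U_def by (intro borel_open open_UN ballI open_greaterThanLessThan)
  have level: "norm x \<in> U" if "maximal_op f x > ennreal lam" for x
  proof (rule ccontr)
    assume "norm x \<notin> U"
    have "\<exists>R\<in>{0<..}. ennreal lam <
        (\<integral>\<^sup>+y\<in>ball x R. ennreal (norm (f y)) \<partial>lebesgue) / emeasure lebesgue (ball x R)"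
      using that unfolding maximal_op_def less_SUP_iff .
    then obtain R where "R \<in> {0<..}" and R: "ennreal lam <
        (\<integral>\<^sup>+y\<in>ball x R. ennreal (norm (f y)) \<partial>lebesgue) / emeasure lebesgue (ball x R)"
      by (rule bexE)
    then have "R > 0" by simp
    have "(\<integral>\<^sup>+y\<in>ball x R. ennreal (norm (f y)) \<partial>lebesgue) = (\<integral>\<^sup>+y\<in>ball x R. g (norm y) \<partial>lborel)"
      unfolding nn_integral_completion
      by (rule nn_integral_cong_AE, use g_norm in eventually_elim) simp
    also have "\<dots> \<le> 2 * ennreal (lam / 2) * emeasure lborel (ball x R)"
    proof (rule nn_integral_radial_ball_le)
      fix I assume I: "is_interval I" "bounded I" "norm x \<in> I"
      show "(\<integral>\<^sup>+t\<in>I. g t \<partial>?\<mu>) \<le> ennreal (lam / 2) * emeasure ?\<mu> I"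
      proof (rule ccontr)
        assume "\<not> ?thesis"
        then have "ennreal (lam / 2) * emeasure ?\<mu> I < (\<integral>\<^sup>+t\<in>I. g t \<partial>?\<mu>)" by simp
        then obtain a b where "norm x \<in> {a<..<b}"
          "ennreal (lam / 2) * emeasure ?\<mu> {a<..<b} < (\<integral>\<^sup>+t\<in>{a<..<b}. g t \<partial>?\<mu>)"
          by (rule interval_average_thicken[OF \<open>?n > 0\<close> \<open>g \<in> borel_measurable borel\<close> I, rotated])
             (simp_all add: ennreal_less_top)
        then have "norm x \<in> U" unfolding U_def F_def by (intro UN_I[of "(a, b)"]) auto
        with \<open>norm x \<notin> U\<close> show False ..
      qed
    qed (use \<open>R > 0\<close> in auto)
    also have "2 * ennreal (lam / 2) = ennreal lam"
      using \<open>lam > 0\<close> by (simp add: ennreal_mult'[symmetric] flip: ennreal_numeral)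
    finally have "(\<integral>\<^sup>+y\<in>ball x R. ennreal (norm (f y)) \<partial>lebesgue) / emeasure lebesgue (ball x R) \<le> ennreal lam"
      using \<open>R > 0\<close> by (intro divide_le_posI_ennreal) (simp_all add: mult.commute emeasure_ball)
    with R show False by simp
  qed
  have "weighted_measure (radial_extension w\<^sub>0) {x. maximal_op f x > ennreal lam} \<le>
      (\<integral>\<^sup>+x. radial_extension w\<^sub>0 x * indicator U (norm (x :: real ^ 'n)) \<partial>lebesgue)"
    unfolding weighted_measure_def by (rule nn_integral_mono) (auto simp: indicator_def level)
  also have "\<dots> = (\<integral>\<^sup>+x. w (norm (x :: real ^ 'n)) * indicator U (norm x) \<partial>lborel)"
    unfolding nn_integral_completion
    by (rule nn_integral_cong_AE, use w_norm in eventually_elim) simp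
  also have "\<dots> = ?\<omega> * (\<integral>\<^sup>+t\<in>U. w t \<partial>?\<mu>)"
    by (rule nn_integral_norm) measurable
  also have "(\<integral>\<^sup>+t\<in>U. w t \<partial>?\<mu>) \<le> ennreal (4 * C / lam) * (\<integral>\<^sup>+t. g t * w t \<partial>?\<mu>)"
  proof -
    have "ennreal (lam / 2) * (\<integral>\<^sup>+t\<in>U. w t \<partial>?\<mu>) \<le> 2 * (ennreal C * (\<integral>\<^sup>+t. g t * w t \<partial>?\<mu>))"
      unfolding U_def by (rule A1_weak_type_intervals[OF \<open>?n > 0\<close> A1 _ _ w]) (simp_all add: F_def)
    then have "ennreal (2 / lam) * (ennreal (lam / 2) * (\<integral>\<^sup>+t\<in>U. w t \<partial>?\<mu>)) \<le>
        ennreal (2 / lam) * (2 * (ennreal C * (\<integral>\<^sup>+t. g t * w t \<partial>?\<mu>)))"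
      by (rule mult_left_mono) simp
    moreover have "ennreal (2 / lam) * ennreal (lam / 2) = 1"
      using \<open>lam > 0\<close> by (simp add: ennreal_mult[symmetric])
    moreover have "ennreal (2 / lam) * 2 * ennreal C = ennreal (4 * C / lam)"
    proof -
      have "ennreal (2 / lam) * ennreal 2 * ennreal C = ennreal (2 / lam * 2 * C)"
        using \<open>lam > 0\<close> \<open>C > 0\<close> by (simp add: ennreal_mult[symmetric] del: ennreal_numeral)
      also have "2 / lam * 2 * C = 4 * C / lam" by simp
      finally show ?thesis by simp
    qed
    ultimately show ?thesis by (simp flip: mult.assoc)
  qed
  also have "?\<omega> * (ennreal (4 * C / lam) * (\<integral>\<^sup>+t. g t * w t \<partial>?\<mu>)) =
      ennreal (4 * C / lam) * (?\<omega> * (\<integral>\<^sup>+t. g t * w t \<partial>?\<mu>))"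
    by (rule mult.left_commute)
  also have "?\<omega> * (\<integral>\<^sup>+t. g t * w t \<partial>?\<mu>) = (\<integral>\<^sup>+x. g (norm (x :: real ^ 'n)) * w (norm x) \<partial>lborel)"
    by (rule nn_integral_norm[symmetric]) measurable
  also have "\<dots> = (\<integral>\<^sup>+x. ennreal (norm (f x)) * radial_extension w\<^sub>0 x \<partial>lebesgue)"
    unfolding nn_integral_completion
    by (rule nn_integral_cong_AE, use w_norm g_norm in eventually_elim) simp
  finally show ?thesis by (simp add: mult_left_mono)
qed

end
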